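(* Let $K_\lambda(t)=\partial_\lambda\log w_\lambda(t)$ and let $X\sim P_\lambda$, the probability law on $J$ with density $w_\lambda/\Phi(\lambda)$ with respect to $\mu$. Suppose that $K_\lambda w_\lambda$ satisfies the regularity condition described in the context. Then $$\partial_\lambda^2\log\Phi(\lambda)=\operatorname{Var}\bigl(K_\lambda(X)\bigr)+\mathbb E\,\partial_\lambda K_\lambda(X).$$ If in addition $\partial_\lambda K_\lambda(t)\ge 0$ for all $t\in J$ (and all $\lambda\in\Lambda$), then $\Phi$ is log-convex in $\lambda$. In particular, when $K_\lambda(t)$ is independent of $\lambda$, $$\partial_\lambda^2\log\Phi(\lambda)=\operatorname{Var}\bigl(K_\lambda(X)\bigr),$$ and $\Phi$ is log-convex in $\lambda$.
   Context: Setting. $\Lambda\subseteq\mathbb R$ is an interval, and $J$ is either an interval of $\mathbb R$, equipped with Lebesgue measure $\mu$, or a subset of $\mathbb N_0=\{0,1,2,\dots\}$, equipped with counting measure $\mu$. For $\lambda\in\Lambda$, $w_\lambda:J\to(0,\infty)$ is a (measurable) positive weight function, and $\Phi(\lambda)=\int_J w_\lambda(t)\,d\mu(t)$ is assumed finite and positive. Regularity of $w_\lambda$ (standing assumption). $\lambda\mapsto\log w_\lambda(t)$ is $C^1$ for every $t\in J$, and for every compact interval $B\subseteq\Lambda$ there is $m_B\in L^1(J,\mu)$ with $\sup_{\lambda\in B}|\partial_\lambda w_\lambda(t)|\le m_B(t)$ for $\mu$-a.e. $t\in J$. Regularity of $K_\lambda w_\lambda$. $\lambda\mapsto K_\lambda(t)w_\lambda(t)$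 is $C^1$ for every $t\in J$, for every compact interval $B\subseteq\Lambda$ there is $m_B\in L^1(J,\mu)$ with $\sup_{\lambda\in B}|\partial_\lambda (K_\lambda(t)w_\lambda(t))|\le m_B(t)$ for $\mu$-a.e. $t\in J$, $\lambda\mapsto K_\lambda(t)$ is differentiable, and $K_\lambda(X)$ and $\partial_\lambda K_\lambda(X)$ are integrable. *)

theory Defs
  imports "HOL-Probability.Probability"
begin

text \<open>
  The index space \<open>J\<close> is a real interval with Lebesgue measure or a set of natural numbers with
  counting measure.  Both cases live in the type \<^typ>\<open>real\<close>, where \<open>\<nat>\<close> is the image of the naturals.
\<close>

definition index_space :: "real set \<Rightarrow> real measure \<Rightarrow> bool" where
  "index_space J \<mu> \<longleftrightarrow>
     (is_interval J \<and> \<mu> = restrict_space lebesgue J) \<or> (J \<subseteq> \<nat> \<and> \<mu> = count_space J)"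

text \<open>
  The parameter interval \<open>\<Lambda>\<close> need not be open, and weights are only meaningful for parameters in
  \<open>\<Lambda>\<close>; so every derivative in the parameter is taken within \<open>\<Lambda>\<close> (one-sided at an endpoint
  belonging to \<open>\<Lambda>\<close>).  For this reason \<open>deriv\<close> and \<open>C1_differentiable_on\<close>, which are
  two-sided, are not used.
\<close>

definition deriv_within :: "real set \<Rightarrow> (real \<Rightarrow> real) \<Rightarrow> real \<Rightarrow> real" where
  "deriv_within S f x = vector_derivative f (at x within S)"

definition C1_within :: "real set \<Rightarrow> (real \<Rightarrow> real) \<Rightarrow> bool" where
  "C1_within S f \<longleftrightarrow> f differentiable_on S \<and> continuous_on S (deriv_within S f)"

definition has_second_deriv_within ::
    "real set \<Rightarrow> (real \<Rightarrow> real) \<Rightarrow> real \<Rightarrow> real \<Rightarrow> bool" where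
  "has_second_deriv_within S f D x \<longleftrightarrow>
     f differentiable_on S \<and> (deriv_within S f has_real_derivative D) (at x within S)"

text \<open>
  The bound on \<open>sup\<close> over \<open>B = {a..b}\<close> is written pointwise, since \<open>Sup\<close> on the reals carries no
  information for unbounded sets; the exceptional null set does not depend on the parameter.
\<close>

definition locally_dominated_deriv ::
    "real set \<Rightarrow> real measure \<Rightarrow> (real \<Rightarrow> real \<Rightarrow> real) \<Rightarrow> bool" where
  "locally_dominated_deriv \<Lambda> \<mu> g \<longleftrightarrow>
     (\<forall>a b. a \<le> b \<and> {a..b} \<subseteq> \<Lambda> \<longrightarrow>
        (\<exists>m. integrable \<mu> m \<and>
             (AE t in \<mu>. \<forall>\<theta>\<in>{a..b}. \<bar>deriv_within \<Lambda> (\<lambda>l. g l t) \<theta>\<bar> \<le> m t)))"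

definition \<Phi> :: "real measure \<Rightarrow> (real \<Rightarrow> real \<Rightarrow> real) \<Rightarrow> real \<Rightarrow> real" where
  "\<Phi> \<mu> w \<theta> = (LINT t|\<mu>. w \<theta> t)"

definition weight_family ::
    "real set \<Rightarrow> real set \<Rightarrow> real measure \<Rightarrow> (real \<Rightarrow> real \<Rightarrow> real) \<Rightarrow> bool" where
  "weight_family \<Lambda> J \<mu> w \<longleftrightarrow>
     is_interval \<Lambda> \<and> index_space J \<mu> \<and>
     (\<forall>\<theta>\<in>\<Lambda>. w \<theta> \<in> borel_measurable \<mu> \<and> (\<forall>t\<in>J. 0 < w \<theta> t) \<and>
             integrable \<mu> (w \<theta>) \<and> 0 < \<Phi> \<mu> w \<theta>)"

definition regular_weight ::
    "real set \<Rightarrow> real set \<Rightarrow> real measure \<Rightarrow> (real \<Rightarrow> real \<Rightarrow> real) \<Rightarrow> bool" where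
  "regular_weight \<Lambda> J \<mu> w \<longleftrightarrow>
     (\<forall>t\<in>J. C1_within \<Lambda> (\<lambda>l. ln (w l t))) \<and> locally_dominated_deriv \<Lambda> \<mu> w"

definition score :: "real set \<Rightarrow> (real \<Rightarrow> real \<Rightarrow> real) \<Rightarrow> real \<Rightarrow> real \<Rightarrow> real" where
  "score \<Lambda> w \<theta> t = deriv_within \<Lambda> (\<lambda>l. ln (w l t)) \<theta>"

definition dscore :: "real set \<Rightarrow> (real \<Rightarrow> real \<Rightarrow> real) \<Rightarrow> real \<Rightarrow> real \<Rightarrow> real" where
  "dscore \<Lambda> w \<theta> t = deriv_within \<Lambda> (\<lambda>l. score \<Lambda> w l t) \<theta>"

text \<open>
  \<open>X \<theta>\<close>, a random variable on \<open>M \<theta>\<close>, has the law \<open>P\<^sub>\<theta>\<close> with \<open>\<mu>\<close>-density \<open>w \<theta> / \<Phi> \<theta>\<close>.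
\<close>

definition has_weight_law ::
    "real set \<Rightarrow> real measure \<Rightarrow> (real \<Rightarrow> real \<Rightarrow> real) \<Rightarrow>
     (real \<Rightarrow> 'a measure) \<Rightarrow> (real \<Rightarrow> 'a \<Rightarrow> real) \<Rightarrow> bool" where
  "has_weight_law \<Lambda> \<mu> w M X \<longleftrightarrow>
     (\<forall>\<theta>\<in>\<Lambda>. prob_space (M \<theta>) \<and>
             distributed (M \<theta>) \<mu> (X \<theta>) (\<lambda>t. ennreal (w \<theta> t / \<Phi> \<mu> w \<theta>)))"

definition regular_score ::
    "real set \<Rightarrow> real set \<Rightarrow> real measure \<Rightarrow> (real \<Rightarrow> real \<Rightarrow> real) \<Rightarrow>
     (real \<Rightarrow> 'a measure) \<Rightarrow> (real \<Rightarrow> 'a \<Rightarrow> real) \<Rightarrow> bool" where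
  "regular_score \<Lambda> J \<mu> w M X \<longleftrightarrow>
     (\<forall>t\<in>J. C1_within \<Lambda> (\<lambda>l. score \<Lambda> w l t * w l t)) \<and>
     locally_dominated_deriv \<Lambda> \<mu> (\<lambda>l t. score \<Lambda> w l t * w l t) \<and>
     (\<forall>t\<in>J. (\<lambda>l. score \<Lambda> w l t) differentiable_on \<Lambda>) \<and>
     (\<forall>\<theta>\<in>\<Lambda>. integrable (M \<theta>) (\<lambda>\<omega>. score \<Lambda> w \<theta> (X \<theta> \<omega>)) \<and>
             integrable (M \<theta>) (\<lambda>\<omega>. dscore \<Lambda> w \<theta> (X \<theta> \<omega>)))"

definition log_convex_on :: "real set \<Rightarrow> (real \<Rightarrow> real) \<Rightarrow> bool" where
  "log_convex_on S f \<longleftrightarrow> (\<forall>x\<in>S. 0 < f x) \<and> convex_on S (\<lambda>x. ln (f x))"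

end

theory Submission
  imports Defs
begin

text \<open>
  Writing \<open>K\<close> for the score, \<open>\<partial>w = K w\<close> and \<open>\<partial>(K w) = (\<partial>K + K\<^sup>2) w\<close>.  Both integrands have locally
  dominated derivatives, so two differentiations under the integral sign give
  \<open>\<Phi>' = \<integral> K w\<close> and \<open>\<Phi>'' = \<integral> (\<partial>K + K\<^sup>2) w\<close>
  (\<open>has_derivative_lebesgue_integral\<close>).  Dividing by \<open>\<Phi>\<close> turns these integrals into expectations
  under \<open>P\<^sub>\<theta>\<close>, and
  \<open>(ln \<Phi>)'' = \<Phi>'' / \<Phi> - (\<Phi>' / \<Phi>)\<^sup>2 = E \<partial>K + E K\<^sup>2 - (E K)\<^sup>2 = E \<partial>K + Var K\<close>.
  The existence of \<open>E K\<^sup>2\<close> is part of the conclusion: \<open>K\<^sup>2 w\<close> is the difference of \<open>\<partial>(K w)\<close>,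
  integrable by domination, and of \<open>\<partial>K w\<close>, integrable because \<open>\<partial>K(X)\<close> is.  Log-convexity follows from
  the sign of the second derivative, by the mean value theorem within \<open>\<Lambda>\<close>
  (\<open>convex_on_second_deriv_within\<close>), which copes with endpoints that belong to \<open>\<Lambda>\<close>.

  The argument needs derivatives within \<open>\<Lambda>\<close> to be unique, hence \<open>\<Lambda>\<close> to have more than one point.  When
  \<open>\<Lambda>\<close> is a single point, \<open>at \<theta> within \<Lambda>\<close> is the trivial filter: every number is a derivative there, and
  the score is the same arbitrary number for all \<open>t\<close>, so every claim is trivial.
\<close>

section \<open>Calculus within an interval\<close>

lemma deriv_within_eqI:
  assumes "at x within S \<noteq> bot" "(f has_real_derivative D) (at x within S)"
  shows "deriv_within S f x = D"
  using assms vector_derivative_within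
  by (auto simp: deriv_within_def has_real_derivative_iff_has_vector_derivative)

lemma has_real_derivative_deriv_within:
  assumes "f differentiable_on S" "x \<in> S"
  shows "(f has_real_derivative deriv_within S f x) (at x within S)"
  using assms vector_derivative_works
  by (auto simp: deriv_within_def differentiable_on_def
        has_real_derivative_iff_has_vector_derivative)

lemma differentiable_on_of_real_derivative:
  assumes "\<And>x. x \<in> S \<Longrightarrow> (f has_real_derivative f' x) (at x within S)"
  shows "f differentiable_on S"
  unfolding differentiable_on_def
  using assms real_differentiable_def by blast

lemma mvt_within_interval:
  fixes f :: "real \<Rightarrow> real"
  assumes S: "is_interval S" "x \<in> S" "y \<in> S" and "x < y"
    and deriv: "\<And>z. z \<in> S \<Longrightarrow> (f has_real_derivative f' z) (at z within S)"
  obtains z where "x < z" "z < y" "f y - f x = f' z * (y - x)"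
proof -
  have sub: "{x..y} \<subseteq> S"
    using mem_is_interval_1_I[OF S] by auto
  have "(f has_derivative (*) (f' z)) (at z within {x..y})" if "x \<le> z" "z \<le> y" for z
  proof -
    have "(f has_real_derivative f' z) (at z within {x..y})"
      using that sub by (intro DERIV_subset[OF deriv sub]) auto
    then show ?thesis
      by (simp add: has_field_derivative_def)
  qed
  from mvt_simple[OF \<open>x < y\<close> this] show ?thesis
    using that by auto
qed

text \<open>
  The library criterion for convexity asks for two-sided derivatives.  The variant here covers intervals
  containing an endpoint: it needs the derivatives only through the mean value theorem, which never looks
  outside the interval.
\<close>

lemma convex_on_second_deriv_within:
  fixes f :: "real \<Rightarrow> real"
  assumes S: "is_interval S"
    and d1: "\<And>x. x \<in> S \<Longrightarrow> (f has_real_derivative f' x) (at x within S)"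
    and d2: "\<And>x. x \<in> S \<Longrightarrow> (f' has_real_derivative f'' x) (at x within S)"
    and nonneg: "\<And>x. x \<in> S \<Longrightarrow> 0 \<le> f'' x"
  shows "convex_on S f"
proof (rule pos_convex_function)
  have between: "z \<in> S" if "x \<in> S" "y \<in> S" "x < z" "z < y" for x y z
    using mem_is_interval_1_I[OF S that(1,2), of z] that by simp
  have mono: "f' x \<le> f' y" if xy: "x \<in> S" "y \<in> S" "x < y" for x y
  proof -
    obtain z where z: "x < z" "z < y" "f' y - f' x = f'' z * (y - x)"
      using mvt_within_interval[OF S xy d2] by blast
    moreover have "0 \<le> f'' z"
      using nonneg between[OF xy(1,2) z(1,2)] .
    ultimately have "0 \<le> f'' z * (y - x)"
      by simp
    with z show ?thesis by simp
  qed
  show "f' x * (y - x) \<le> f y - f x" if xy: "x \<in> S" "y \<in> S" for x y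
  proof (cases x y rule: linorder_cases)
    case less
    obtain z where z: "x < z" "z < y" "f y - f x = f' z * (y - x)"
      using mvt_within_interval[OF S xy less d1] by blast
    then have "f' x * (y - x) \<le> f' z * (y - x)"
      using mono[OF xy(1) between[OF xy z(1,2)]] by (intro mult_right_mono) auto
    with z show ?thesis by simp
  next
    case greater
    obtain z where z: "y < z" "z < x" "f x - f y = f' z * (x - y)"
      using mvt_within_interval[OF S xy(2,1) greater d1] by blast
    then have "f' z * (x - y) \<le> f' x * (x - y)"
      using mono[OF between[OF xy(2,1) z(1,2)] xy(1)] by (intro mult_right_mono) auto
    with z show ?thesis by (simp add: algebra_simps)
  qed simp
qed (use S is_interval_convex in auto)

lemma interval_hull_of_convergent_sequence:
  fixes s :: "nat \<Rightarrow> real"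
  assumes S: "is_interval S" "x \<in> S" and s: "\<And>n. s n \<in> S" "s \<longlonglongrightarrow> x"
  obtains a b where "a \<le> b" "{a..b} \<subseteq> S" "x \<in> {a..b}" "\<And>n. s n \<in> {a..b}"
proof -
  have K: "compact (insert x (range s))" "insert x (range s) \<noteq> {}"
    using compact_sequence_with_limit[OF s(2)] by auto
  obtain a where a: "a \<in> insert x (range s)" "\<And>y. y \<in> insert x (range s) \<Longrightarrow> a \<le> y"
    using compact_attains_inf[OF K] by blast
  obtain b where b: "b \<in> insert x (range s)" "\<And>y. y \<in> insert x (range s) \<Longrightarrow> y \<le> b"
    using compact_attains_sup[OF K] by blast
  have "a \<in> S" "b \<in> S"
    using a(1) b(1) S s by auto
  from mem_is_interval_1_I[OF S(1) this] have "{a..b} \<subseteq> S"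
    by auto
  then show ?thesis
    using that[of a b] a(2) b(2) by force
qed

section \<open>Differentiation under the integral sign\<close>

text \<open>
  Along a sequence in \<open>S\<close> converging to \<open>x\<close>, the difference quotients of \<open>g\<close> converge to the derivative and,
  by the mean value theorem, obey the bound of the derivative on a compact interval containing the whole
  sequence; so dominated convergence applies.  The integrability of \<open>g' x\<close> comes out of the
  same limit, and its measurability needs a sequence to exist at all, that is, \<open>x\<close> must be a limit
  point of \<open>S\<close>.
\<close>

lemma has_derivative_lebesgue_integral:
  fixes g g' :: "real \<Rightarrow> 'b \<Rightarrow> real"
  assumes S: "is_interval S" "x \<in> S" "at x within S \<noteq> bot"
    and int: "\<And>l. l \<in> S \<Longrightarrow> integrable M (g l)"
    and deriv: "\<And>l t. l \<in> S \<Longrightarrow> t \<in> space M \<Longrightarrow>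
                  ((\<lambda>l. g l t) has_real_derivative g' l t) (at l within S)"
    and dom: "\<And>a b. a \<le> b \<Longrightarrow> {a..b} \<subseteq> S \<Longrightarrow>
                \<exists>m. integrable M m \<and> (AE t in M. \<forall>l\<in>{a..b}. \<bar>g' l t\<bar> \<le> m t)"
  shows "integrable M (g' x)"
    and "((\<lambda>l. LINT t|M. g l t) has_real_derivative (LINT t|M. g' x t)) (at x within S)"
proof -
  have key: "integrable M (g' x) \<and>
      (\<lambda>n. ((LINT t|M. g (s n) t) - (LINT t|M. g x t)) / (s n - x)) \<longlonglongrightarrow> (LINT t|M. g' x t)"
    if s: "\<And>n. s n \<in> S - {x}" "s \<longlonglongrightarrow> x" for s :: "nat \<Rightarrow> real"
  proof -
    obtain a b where ab: "a \<le> b" "{a..b} \<subseteq> S" "x \<in> {a..b}" "\<And>n. s n \<in> {a..b}"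
      using interval_hull_of_convergent_sequence[of S x s] S s by blast
    obtain m where m: "integrable M m" "AE t in M. \<forall>l\<in>{a..b}. \<bar>g' l t\<bar> \<le> m t"
      using dom[OF ab(1,2)] by blast
    define q where "q n t = (g (s n) t - g x t) / (s n - x)" for n t
    have q_int: "integrable M (q n)" for n
      unfolding q_def using int s S by (intro integrable_divide_zero integrable_diff) auto
    have lim: "(\<lambda>n. q n t) \<longlonglongrightarrow> g' x t" if "t \<in> space M" for t
      using deriv[OF S(2) that] s
      unfolding has_field_derivative_iff tendsto_at_iff_sequentially comp_def q_def by blast
    have meas: "g' x \<in> borel_measurable M"
      using lim by (rule borel_measurable_LIMSEQ_real[where u = q])
        (use q_int in auto)
    have bound: "AE t in M. norm (q n t) \<le> m t" for n
      using m(2) AE_space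
    proof eventually_elim
      case (elim t)
      obtain z where z: "z \<in> {a..b}" "g (s n) t - g x t = g' z t * (s n - x)"
      proof (cases "x < s n")
        case True
        obtain z where "x < z" "z < s n" "g (s n) t - g x t = g' z t * (s n - x)"
          using mvt_within_interval[OF S(1,2) _ True deriv] s elim by blast
        then show ?thesis
          using that[of z] ab(3) ab(4)[of n] by auto
      next
        case False
        then have "s n < x" using s(1)[of n] by auto
        obtain z where "s n < z" "z < x" "g x t - g (s n) t = g' z t * (x - s n)"
          using mvt_within_interval[OF S(1) _ S(2) \<open>s n < x\<close> deriv] s elim by blast
        then show ?thesis
          using that[of z] ab(3) ab(4)[of n] by (auto simp: algebra_simps)
      qed
      then have "q n t = g' z t"
        using s(1)[of n] by (simp add: q_def)
      with z elim show ?case by simp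
    qed
    have AE_lim: "AE t in M. (\<lambda>n. q n t) \<longlonglongrightarrow> g' x t"
      using lim by simp
    note dct = meas borel_measurable_integrable[OF q_int] m(1) AE_lim bound
    have "(\<lambda>n. LINT t|M. q n t) \<longlonglongrightarrow> (LINT t|M. g' x t)"
      by (rule integral_dominated_convergence[OF dct])
    moreover have "(LINT t|M. q n t) = ((LINT t|M. g (s n) t) - (LINT t|M. g x t)) / (s n - x)"
      for n
      unfolding q_def using int s S by (subst integral_divide_zero, subst Bochner_Integration.integral_diff) auto
    ultimately show ?thesis
      using integrable_dominated_convergence[OF dct] by simp
  qed
  obtain s :: "nat \<Rightarrow> real" where "\<And>n. s n \<in> S - {x}" "s \<longlonglongrightarrow> x"
    using S(3) unfolding trivial_limit_within not_not islimpt_sequential by metis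
  then show "integrable M (g' x)"
    using key by blast
  show "((\<lambda>l. LINT t|M. g l t) has_real_derivative (LINT t|M. g' x t)) (at x within S)"
    unfolding has_field_derivative_iff tendsto_at_iff_sequentially comp_def
  proof (intro allI impI)
    fix s assume "\<forall>n. s n \<in> S - {x}" "s \<longlonglongrightarrow> x"
    then show "(\<lambda>n. ((LINT t|M. g (s n) t) - (LINT t|M. g x t)) / (s n - x)) \<longlonglongrightarrow> (LINT t|M. g' x t)"
      using key[of s] by simp
  qed
qed

section \<open>Derivatives of the normalising integral\<close>

lemma index_space_space: "index_space J \<mu> \<Longrightarrow> space \<mu> = J"
  by (auto simp: index_space_def space_restrict_space)

lemma weight_has_derivative:
  assumes "weight_family \<Lambda> J \<mu> w" "regular_weight \<Lambda> J \<mu> w" "\<theta> \<in> \<Lambda>" "t \<in> J"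
  shows "((\<lambda>l. w l t) has_real_derivative score \<Lambda> w \<theta> t * w \<theta> t) (at \<theta> within \<Lambda>)"
proof -
  have pos: "0 < w l t" if "l \<in> \<Lambda>" for l
    using assms that by (auto simp: weight_family_def)
  have "((\<lambda>l. ln (w l t)) has_real_derivative score \<Lambda> w \<theta> t) (at \<theta> within \<Lambda>)"
    unfolding score_def using assms
    by (intro has_real_derivative_deriv_within) (auto simp: regular_weight_def C1_within_def)
  from DERIV_chain2[OF DERIV_exp this]
  have "((\<lambda>l. exp (ln (w l t))) has_real_derivative score \<Lambda> w \<theta> t * w \<theta> t) (at \<theta> within \<Lambda>)"
    using pos[OF assms(3)] by (simp add: mult.commute)
  then show ?thesis
    by (rule has_field_derivative_transform_within[where d = 1]) (use pos assms(3) in auto)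
qed

lemma score_weight_has_derivative:
  assumes wf: "weight_family \<Lambda> J \<mu> w" "regular_weight \<Lambda> J \<mu> w"
    and "regular_score \<Lambda> J \<mu> w M X" "\<theta> \<in> \<Lambda>" "t \<in> J"
  shows "((\<lambda>l. score \<Lambda> w l t * w l t) has_real_derivative
            (dscore \<Lambda> w \<theta> t + (score \<Lambda> w \<theta> t)\<^sup>2) * w \<theta> t) (at \<theta> within \<Lambda>)"
proof -
  have "((\<lambda>l. score \<Lambda> w l t) has_real_derivative dscore \<Lambda> w \<theta> t) (at \<theta> within \<Lambda>)"
    unfolding dscore_def using assms
    by (intro has_real_derivative_deriv_within) (auto simp: regular_score_def)
  from DERIV_mult[OF this weight_has_derivative[OF wf assms(4,5)]] show ?thesis
    by (simp add: algebra_simps power2_eq_square)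
qed

text \<open>
  The domination hypothesis speaks of \<open>deriv_within \<Lambda>\<close>; where limits are unique this is the product
  \<open>score * w\<close>, so that the hypothesis bounds the integrand obtained by differentiating \<open>w\<close>.
\<close>

lemma \<Phi>_has_derivative:
  assumes wf: "weight_family \<Lambda> J \<mu> w" and rw: "regular_weight \<Lambda> J \<mu> w"
    and nontriv: "\<forall>l\<in>\<Lambda>. at l within \<Lambda> \<noteq> bot" and \<theta>: "\<theta> \<in> \<Lambda>"
  shows "integrable \<mu> (\<lambda>t. score \<Lambda> w \<theta> t * w \<theta> t)" (is ?int)
    and "(\<Phi> \<mu> w has_real_derivative (LINT t|\<mu>. score \<Lambda> w \<theta> t * w \<theta> t)) (at \<theta> within \<Lambda>)" (is ?deriv)
proof -
  have J: "space \<mu> = J" "is_interval \<Lambda>"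
    using wf index_space_space by (auto simp: weight_family_def)
  have dom: "\<exists>m. integrable \<mu> m \<and> (AE t in \<mu>. \<forall>l\<in>{a..b}. \<bar>score \<Lambda> w l t * w l t\<bar> \<le> m t)"
    if ab: "a \<le> b" "{a..b} \<subseteq> \<Lambda>" for a b
  proof -
    obtain m where m: "integrable \<mu> m"
        "AE t in \<mu>. \<forall>l\<in>{a..b}. \<bar>deriv_within \<Lambda> (\<lambda>l. w l t) l\<bar> \<le> m t"
      using rw ab unfolding regular_weight_def locally_dominated_deriv_def by blast
    have "AE t in \<mu>. \<forall>l\<in>{a..b}. \<bar>score \<Lambda> w l t * w l t\<bar> \<le> m t"
      using m(2) AE_space
    proof eventually_elim
      case (elim t)
      have "deriv_within \<Lambda> (\<lambda>l. w l t) l = score \<Lambda> w l t * w l t" if "l \<in> {a..b}" for l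
        using that ab elim J nontriv
        by (intro deriv_within_eqI weight_has_derivative[OF wf rw]) auto
      with elim show ?case by simp
    qed
    with m(1) show ?thesis by blast
  qed
  have int: "integrable \<mu> (w l)" if "l \<in> \<Lambda>" for l
    using wf that by (auto simp: weight_family_def)
  note * = has_derivative_lebesgue_integral[where g = w and g' = "\<lambda>l t. score \<Lambda> w l t * w l t",
      OF J(2) \<theta> nontriv[rule_format, OF \<theta>] int weight_has_derivative[OF wf rw, folded J(1)] dom]
  show ?int
    using * by blast
  have "\<Phi> \<mu> w = (\<lambda>l. LINT t|\<mu>. w l t)"
    by (simp add: \<Phi>_def fun_eq_iff)
  then show ?deriv
    using * by simp
qed

lemma integral_score_has_derivative:
  assumes wf: "weight_family \<Lambda> J \<mu> w" and rw: "regular_weight \<Lambda> J \<mu> w"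
    and rs: "regular_score \<Lambda> J \<mu> w M X"
    and nontriv: "\<forall>l\<in>\<Lambda>. at l within \<Lambda> \<noteq> bot" and \<theta>: "\<theta> \<in> \<Lambda>"
  shows "integrable \<mu> (\<lambda>t. (dscore \<Lambda> w \<theta> t + (score \<Lambda> w \<theta> t)\<^sup>2) * w \<theta> t)" (is ?int)
    and "((\<lambda>l. LINT t|\<mu>. score \<Lambda> w l t * w l t) has_real_derivative
            (LINT t|\<mu>. (dscore \<Lambda> w \<theta> t + (score \<Lambda> w \<theta> t)\<^sup>2) * w \<theta> t)) (at \<theta> within \<Lambda>)" (is ?deriv)
proof -
  have J: "space \<mu> = J" "is_interval \<Lambda>"
    using wf index_space_space by (auto simp: weight_family_def)
  have dom: "\<exists>m. integrable \<mu> m \<and>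
      (AE t in \<mu>. \<forall>l\<in>{a..b}. \<bar>(dscore \<Lambda> w l t + (score \<Lambda> w l t)\<^sup>2) * w l t\<bar> \<le> m t)"
    if ab: "a \<le> b" "{a..b} \<subseteq> \<Lambda>" for a b
  proof -
    obtain m where m: "integrable \<mu> m"
        "AE t in \<mu>. \<forall>l\<in>{a..b}. \<bar>deriv_within \<Lambda> (\<lambda>l. score \<Lambda> w l t * w l t) l\<bar> \<le> m t"
      using rs ab unfolding regular_score_def locally_dominated_deriv_def by blast
    have "AE t in \<mu>. \<forall>l\<in>{a..b}. \<bar>(dscore \<Lambda> w l t + (score \<Lambda> w l t)\<^sup>2) * w l t\<bar> \<le> m t"
      using m(2) AE_space
    proof eventually_elim
      case (elim t)
      have "deriv_within \<Lambda> (\<lambda>l. score \<Lambda> w l t * w l t) l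
              = (dscore \<Lambda> w l t + (score \<Lambda> w l t)\<^sup>2) * w l t" if "l \<in> {a..b}" for l
        using that ab elim J nontriv
        by (intro deriv_within_eqI score_weight_has_derivative[OF wf rw rs]) auto
      with elim show ?case by simp
    qed
    with m(1) show ?thesis by blast
  qed
  note * = has_derivative_lebesgue_integral[where g = "\<lambda>l t. score \<Lambda> w l t * w l t"
        and g' = "\<lambda>l t. (dscore \<Lambda> w l t + (score \<Lambda> w l t)\<^sup>2) * w l t",
      OF J(2) \<theta> nontriv[rule_format, OF \<theta>] \<Phi>_has_derivative(1)[OF wf rw nontriv]
        score_weight_has_derivative[OF wf rw rs, folded J(1)] dom]
  show ?int ?deriv
    using * by blast+
qed

section \<open>From integrals to moments of the score\<close>

text \<open>
  Only \<open>h * w \<theta>\<close> is assumed measurable, because only such products arise as limits of difference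
  quotients; \<open>h\<close> itself is recovered by dividing by the positive weight.
\<close>

lemma weight_law_transfer:
  assumes wf: "weight_family \<Lambda> J \<mu> w" and law: "has_weight_law \<Lambda> \<mu> w M X" and \<theta>: "\<theta> \<in> \<Lambda>"
    and h: "(\<lambda>t. h t * w \<theta> t) \<in> borel_measurable \<mu>"
  shows "integrable (M \<theta>) (\<lambda>\<omega>. h (X \<theta> \<omega>)) \<longleftrightarrow> integrable \<mu> (\<lambda>t. h t * w \<theta> t)" (is ?int)
    and "prob_space.expectation (M \<theta>) (\<lambda>\<omega>. h (X \<theta> \<omega>)) = (LINT t|\<mu>. h t * w \<theta> t) / \<Phi> \<mu> w \<theta>" (is ?exp)
proof -
  have J: "space \<mu> = J"
    using wf index_space_space by (auto simp: weight_family_def)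
  have w: "w \<theta> \<in> borel_measurable \<mu>" "\<And>t. t \<in> J \<Longrightarrow> 0 < w \<theta> t" "0 < \<Phi> \<mu> w \<theta>"
    using wf \<theta> by (auto simp: weight_family_def)
  have dist: "distributed (M \<theta>) \<mu> (X \<theta>) (\<lambda>t. ennreal (w \<theta> t / \<Phi> \<mu> w \<theta>))"
    using law \<theta> by (auto simp: has_weight_law_def)
  have "(\<lambda>t. (h t * w \<theta> t) / w \<theta> t) \<in> borel_measurable \<mu>"
    using h w(1) by (rule borel_measurable_divide)
  moreover have "(h t * w \<theta> t) / w \<theta> t = h t" if "t \<in> space \<mu>" for t
    using w(2)[of t] that J by simp
  ultimately have h': "h \<in> borel_measurable \<mu>"
    by (subst (asm) measurable_cong) auto
  have nonneg: "0 \<le> w \<theta> t / \<Phi> \<mu> w \<theta>" if "t \<in> space \<mu>" for t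
    using w(2)[of t] w(3) that J by simp
  have swap: "w \<theta> t / \<Phi> \<mu> w \<theta> * h t = h t * w \<theta> t / \<Phi> \<mu> w \<theta>" for t
    by simp
  show ?int
    using distributed_integrable[OF dist h' nonneg] w(3) unfolding swap
    by (simp add: divide_inverse integrable_mult_left_iff)
  show ?exp
    using distributed_integral[OF dist h' nonneg] unfolding swap by simp
qed

lemma second_deriv_ln_\<Phi>:
  assumes wf: "weight_family \<Lambda> J \<mu> w" and rw: "regular_weight \<Lambda> J \<mu> w"
    and law: "has_weight_law \<Lambda> \<mu> w M X" and rs: "regular_score \<Lambda> J \<mu> w M X"
    and nontriv: "\<forall>l\<in>\<Lambda>. at l within \<Lambda> \<noteq> bot" and \<theta>: "\<theta> \<in> \<Lambda>"
  shows "integrable (M \<theta>) (\<lambda>\<omega>. (score \<Lambda> w \<theta> (X \<theta> \<omega>))\<^sup>2)" (is ?int)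
    and "has_second_deriv_within \<Lambda> (\<lambda>l. ln (\<Phi> \<mu> w l))
              (prob_space.variance (M \<theta>) (\<lambda>\<omega>. score \<Lambda> w \<theta> (X \<theta> \<omega>)) +
               prob_space.expectation (M \<theta>) (\<lambda>\<omega>. dscore \<Lambda> w \<theta> (X \<theta> \<omega>))) \<theta>" (is ?deriv)
proof -
  let ?K = "score \<Lambda> w" and ?dK = "dscore \<Lambda> w"
  interpret prob_space "M \<theta>"
    using law \<theta> by (auto simp: has_weight_law_def)
  have pos: "0 < \<Phi> \<mu> w l" if "l \<in> \<Lambda>" for l
    using wf that by (auto simp: weight_family_def)
  have w[measurable]: "w \<theta> \<in> borel_measurable \<mu>"
    using wf \<theta> by (auto simp: weight_family_def)
  note d1 = \<Phi>_has_derivative[OF wf rw nontriv]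
  note d2 = integral_score_has_derivative[OF wf rw rs nontriv]
  have J: "space \<mu> = J"
    using wf index_space_space by (auto simp: weight_family_def)
  have wpos: "0 < w \<theta> t" if "t \<in> space \<mu>" for t
    using wf \<theta> that J by (auto simp: weight_family_def)
  have Kw[measurable]: "(\<lambda>t. ?K \<theta> t * w \<theta> t) \<in> borel_measurable \<mu>"
    and sum[measurable]: "(\<lambda>t. (?dK \<theta> t + (?K \<theta> t)\<^sup>2) * w \<theta> t) \<in> borel_measurable \<mu>"
    using d1(1)[OF \<theta>] d2(1)[OF \<theta>] by auto
  \<comment> \<open>Neither summand of \<open>(\<partial>K + K\<^sup>2) w\<close> is measurable by hypothesis: \<open>K\<^sup>2 w\<close> is recovered from \<open>K w\<close>,
    and then \<open>\<partial>K w\<close> by subtraction.\<close>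
  have "(\<lambda>t. (?K \<theta> t * w \<theta> t)\<^sup>2 / w \<theta> t) \<in> borel_measurable \<mu>"
    by measurable
  moreover have "(?K \<theta> t * w \<theta> t)\<^sup>2 / w \<theta> t = (?K \<theta> t)\<^sup>2 * w \<theta> t" if "t \<in> space \<mu>" for t
    using wpos[OF that] by (simp add: power2_eq_square)
  ultimately have K2w: "(\<lambda>t. (?K \<theta> t)\<^sup>2 * w \<theta> t) \<in> borel_measurable \<mu>"
    by (subst (asm) measurable_cong) auto
  have split: "?dK \<theta> t * w \<theta> t = (?dK \<theta> t + (?K \<theta> t)\<^sup>2) * w \<theta> t - (?K \<theta> t)\<^sup>2 * w \<theta> t" for t
    by (simp add: algebra_simps)
  have dKw: "(\<lambda>t. ?dK \<theta> t * w \<theta> t) \<in> borel_measurable \<mu>"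
    unfolding split using sum K2w by (rule borel_measurable_diff)
  note transfer_K = weight_law_transfer[OF wf law \<theta> Kw]
    and transfer_K2 = weight_law_transfer[OF wf law \<theta> K2w]
    and transfer_dK = weight_law_transfer[OF wf law \<theta> dKw]
  have E_int: "integrable (M \<theta>) (\<lambda>\<omega>. ?K \<theta> (X \<theta> \<omega>))" "integrable (M \<theta>) (\<lambda>\<omega>. ?dK \<theta> (X \<theta> \<omega>))"
    using rs \<theta> by (auto simp: regular_score_def)
  have dK_int: "integrable \<mu> (\<lambda>t. ?dK \<theta> t * w \<theta> t)"
    using E_int(2) transfer_dK(1) by simp
  have "(?K \<theta> t)\<^sup>2 * w \<theta> t = (?dK \<theta> t + (?K \<theta> t)\<^sup>2) * w \<theta> t - ?dK \<theta> t * w \<theta> t" for t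
    by (simp add: algebra_simps)
  then have K2_int: "integrable \<mu> (\<lambda>t. (?K \<theta> t)\<^sup>2 * w \<theta> t)"
    using Bochner_Integration.integrable_diff[OF d2(1)[OF \<theta>] dK_int] by simp
  show ?int
    using K2_int transfer_K2(1) by simp
  have d_ln: "((\<lambda>l. ln (\<Phi> \<mu> w l)) has_real_derivative
      (LINT t|\<mu>. ?K l t * w l t) / \<Phi> \<mu> w l) (at l within \<Lambda>)" if "l \<in> \<Lambda>" for l
    using d1(2)[OF that] pos[OF that] by (auto intro!: derivative_eq_intros)
  have dw: "deriv_within \<Lambda> (\<lambda>l. ln (\<Phi> \<mu> w l)) l = (LINT t|\<mu>. ?K l t * w l t) / \<Phi> \<mu> w l"
    if "l \<in> \<Lambda>" for l
    using deriv_within_eqI[OF nontriv[rule_format] d_ln] that by blast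
  define I1 I2 where "I1 = (LINT t|\<mu>. ?K \<theta> t * w \<theta> t)"
    and "I2 = (LINT t|\<mu>. (?dK \<theta> t + (?K \<theta> t)\<^sup>2) * w \<theta> t)"
  have "((\<lambda>l. (LINT t|\<mu>. ?K l t * w l t) / \<Phi> \<mu> w l) has_real_derivative
      (I2 * \<Phi> \<mu> w \<theta> - I1 * I1) / (\<Phi> \<mu> w \<theta> * \<Phi> \<mu> w \<theta>)) (at \<theta> within \<Lambda>)"
    unfolding I1_def I2_def using pos[OF \<theta>] by (intro DERIV_divide d1(2)[OF \<theta>] d2(2)[OF \<theta>]) auto
  then have "(deriv_within \<Lambda> (\<lambda>l. ln (\<Phi> \<mu> w l)) has_real_derivative
      (I2 * \<Phi> \<mu> w \<theta> - I1 * I1) / (\<Phi> \<mu> w \<theta> * \<Phi> \<mu> w \<theta>)) (at \<theta> within \<Lambda>)"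
    by (rule has_field_derivative_transform_within[where d = 1]) (use \<theta> dw in auto)
  moreover have "variance (\<lambda>\<omega>. ?K \<theta> (X \<theta> \<omega>)) + expectation (\<lambda>\<omega>. ?dK \<theta> (X \<theta> \<omega>))
      = (I2 * \<Phi> \<mu> w \<theta> - I1 * I1) / (\<Phi> \<mu> w \<theta> * \<Phi> \<mu> w \<theta>)"
  proof -
    define A B where "A = (LINT t|\<mu>. ?dK \<theta> t * w \<theta> t)" and "B = (LINT t|\<mu>. (?K \<theta> t)\<^sup>2 * w \<theta> t)"
    have I2: "I2 = A + B"
      unfolding I2_def A_def B_def distrib_right using dK_int K2_int
      by (rule Bochner_Integration.integral_add)
    have var: "variance (\<lambda>\<omega>. ?K \<theta> (X \<theta> \<omega>)) = B / \<Phi> \<mu> w \<theta> - (I1 / \<Phi> \<mu> w \<theta>)\<^sup>2"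
      using variance_eq[OF E_int(1) \<open>?int\<close>] transfer_K(2) transfer_K2(2)
      by (simp only: I1_def B_def)
    show ?thesis
      unfolding var transfer_dK(2) A_def[symmetric] I2
      using pos[OF \<theta>] by (simp add: field_simps power2_eq_square)
  qed
  ultimately show ?deriv
    unfolding has_second_deriv_within_def
    using differentiable_on_of_real_derivative[of \<Lambda>, OF d_ln] by simp
qed

lemma log_convex_on_of_second_deriv:
  assumes "is_interval S" and pos: "\<And>x. x \<in> S \<Longrightarrow> 0 < f x"
    and d: "\<And>x. x \<in> S \<Longrightarrow> has_second_deriv_within S (\<lambda>l. ln (f l)) (D x) x"
    and nonneg: "\<And>x. x \<in> S \<Longrightarrow> 0 \<le> D x"
  shows "log_convex_on S f"
proof -
  have "convex_on S (\<lambda>l. ln (f l))"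
    using assms(1) _ _ nonneg
  proof (rule convex_on_second_deriv_within)
    show "((\<lambda>l. ln (f l)) has_real_derivative deriv_within S (\<lambda>l. ln (f l)) x) (at x within S)"
      if "x \<in> S" for x
      using d[OF that] that
      by (intro has_real_derivative_deriv_within) (auto simp: has_second_deriv_within_def)
    show "(deriv_within S (\<lambda>l. ln (f l)) has_real_derivative D x) (at x within S)"
      if "x \<in> S" for x
      using d[OF that] by (simp add: has_second_deriv_within_def)
  qed
  with pos show ?thesis
    by (simp add: log_convex_on_def)
qed

section \<open>One-point parameter intervals\<close>

lemma at_within_singleton: "at x within {x} = (bot :: 'a::t1_space filter)"
  by (simp add: at_within_def)

lemma has_second_deriv_within_singleton: "has_second_deriv_within {x} f D x"
  by (auto simp: has_second_deriv_within_def differentiable_on_def differentiable_def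
      at_within_singleton intro!: exI[of _ "\<lambda>_. 0"])

text \<open>
  Over the trivial filter every number is a derivative, so \<open>deriv_within\<close> selects one that does not depend
  on the function.
\<close>

lemma score_singleton: "score {x} w x t = score {x} w x t'"
  by (auto simp: score_def deriv_within_def vector_derivative_def at_within_singleton
      has_vector_derivative_def bounded_linear_mult_left has_derivative_bot)

section \<open>Second derivative and log-convexity of the normaliser\<close>

theorem lemma2p22:
  fixes \<Lambda> J :: "real set" and \<mu> :: "real measure" and w :: "real \<Rightarrow> real \<Rightarrow> real"
    and M :: "real \<Rightarrow> 'a measure" and X :: "real \<Rightarrow> 'a \<Rightarrow> real"
  assumes "weight_family \<Lambda> J \<mu> w"
    and "regular_weight \<Lambda> J \<mu> w"
    and "has_weight_law \<Lambda> \<mu> w M X"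
    and "regular_score \<Lambda> J \<mu> w M X"
  shows "(\<forall>\<theta>\<in>\<Lambda>.
            integrable (M \<theta>) (\<lambda>\<omega>. (score \<Lambda> w \<theta> (X \<theta> \<omega>))\<^sup>2) \<and>
            has_second_deriv_within \<Lambda> (\<lambda>l. ln (\<Phi> \<mu> w l))
              (prob_space.variance (M \<theta>) (\<lambda>\<omega>. score \<Lambda> w \<theta> (X \<theta> \<omega>)) +
               prob_space.expectation (M \<theta>) (\<lambda>\<omega>. dscore \<Lambda> w \<theta> (X \<theta> \<omega>))) \<theta>)
       \<and> ((\<forall>\<theta>\<in>\<Lambda>. \<forall>t\<in>J. 0 \<le> dscore \<Lambda> w \<theta> t) \<longrightarrow> log_convex_on \<Lambda> (\<Phi> \<mu> w))
       \<and> ((\<forall>t\<in>J. \<exists>c. \<forall>\<theta>\<in>\<Lambda>. score \<Lambda> w \<theta> t = c) \<longrightarrow>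
            (\<forall>\<theta>\<in>\<Lambda>. has_second_deriv_within \<Lambda> (\<lambda>l. ln (\<Phi> \<mu> w l))
                     (prob_space.variance (M \<theta>) (\<lambda>\<omega>. score \<Lambda> w \<theta> (X \<theta> \<omega>))) \<theta>) \<and>
            log_convex_on \<Lambda> (\<Phi> \<mu> w))"
proof -
  note wf = assms(1) and law = assms(3)
  have \<Lambda>: "is_interval \<Lambda>" and pos: "\<And>\<theta>. \<theta> \<in> \<Lambda> \<Longrightarrow> 0 < \<Phi> \<mu> w \<theta>" and J: "space \<mu> = J"
    using wf index_space_space by (auto simp: weight_family_def)
  have prob: "prob_space (M \<theta>)" if "\<theta> \<in> \<Lambda>" for \<theta>
    using law that by (auto simp: has_weight_law_def)
  have X: "X \<theta> \<omega> \<in> J" if "\<theta> \<in> \<Lambda>" "\<omega> \<in> space (M \<theta>)" for \<theta> \<omega>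
    using law that J unfolding has_weight_law_def
    by (metis distributed_measurable measurable_space)
  let ?V = "\<lambda>\<theta>. prob_space.variance (M \<theta>) (\<lambda>\<omega>. score \<Lambda> w \<theta> (X \<theta> \<omega>))"
  let ?E = "\<lambda>\<theta>. prob_space.expectation (M \<theta>) (\<lambda>\<omega>. dscore \<Lambda> w \<theta> (X \<theta> \<omega>))"
  have V: "0 \<le> ?V \<theta>" for \<theta>
    by simp
  show ?thesis
  proof (cases "\<exists>x. \<Lambda> = {x}")
    case True
    then obtain x where x: "\<Lambda> = {x}" by blast
    interpret prob_space "M x"
      using prob x by simp
    have "integrable (M x) (\<lambda>\<omega>. (score {x} w x (X x \<omega>))\<^sup>2)"
      by (subst score_singleton[where t' = 0]) simp
    moreover have "log_convex_on {x} (\<Phi> \<mu> w)"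
      using pos \<Lambda> unfolding x
      by (intro log_convex_on_of_second_deriv[where D = "\<lambda>_. 0"])
        (auto intro: has_second_deriv_within_singleton)
    ultimately show ?thesis
      by (simp add: x has_second_deriv_within_singleton)
  next
    case False
    have nontriv: "\<forall>l\<in>\<Lambda>. at l within \<Lambda> \<noteq> bot"
      using connected_imp_perfect[of \<Lambda>] \<Lambda> False
      by (auto simp: trivial_limit_within is_interval_connected)
    note second = second_deriv_ln_\<Phi>[OF assms nontriv]
    have convex: "log_convex_on \<Lambda> (\<Phi> \<mu> w)" if "\<forall>\<theta>\<in>\<Lambda>. \<forall>t\<in>J. 0 \<le> dscore \<Lambda> w \<theta> t"
      using \<Lambda> pos second(2)
    proof (rule log_convex_on_of_second_deriv)
      fix \<theta> assume "\<theta> \<in> \<Lambda>"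
      then have "0 \<le> ?E \<theta>"
        using that X by (intro Bochner_Integration.integral_nonneg) auto
      with V show "0 \<le> ?V \<theta> + ?E \<theta>"
        by (rule add_nonneg_nonneg)
    qed
    have const: "dscore \<Lambda> w \<theta> t = 0"
      if c: "\<forall>t\<in>J. \<exists>c. \<forall>\<theta>\<in>\<Lambda>. score \<Lambda> w \<theta> t = c" and "\<theta> \<in> \<Lambda>" "t \<in> J" for \<theta> t
    proof -
      obtain k where k: "\<And>l. l \<in> \<Lambda> \<Longrightarrow> k = score \<Lambda> w l t"
        using c \<open>t \<in> J\<close> by metis
      have "((\<lambda>l. score \<Lambda> w l t) has_real_derivative 0) (at \<theta> within \<Lambda>)"
        by (rule has_field_derivative_transform_within[OF DERIV_const zero_less_one \<open>\<theta> \<in> \<Lambda>\<close> k])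
      then show ?thesis
        unfolding dscore_def using nontriv \<open>\<theta> \<in> \<Lambda>\<close> by (intro deriv_within_eqI) auto
    qed
    have "has_second_deriv_within \<Lambda> (\<lambda>l. ln (\<Phi> \<mu> w l)) (?V \<theta>) \<theta>"
      if c: "\<forall>t\<in>J. \<exists>c. \<forall>\<theta>\<in>\<Lambda>. score \<Lambda> w \<theta> t = c" and \<theta>: "\<theta> \<in> \<Lambda>" for \<theta>
    proof -
      have "?E \<theta> = (LINT \<omega>|M \<theta>. 0)"
        using const[OF c \<theta>] X[OF \<theta>] by (intro Bochner_Integration.integral_cong) auto
      then show ?thesis
        using second(2)[OF \<theta>] by simp
    qed
    moreover have "log_convex_on \<Lambda> (\<Phi> \<mu> w)"
      if "\<forall>t\<in>J. \<exists>c. \<forall>\<theta>\<in>\<Lambda>. score \<Lambda> w \<theta> t = c"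
      using convex const[OF that] by simp
    ultimately show ?thesis
      using second convex by blast
  qed
qed

end
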